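(* Let $\Pi$ be an enumeration problem whose solutions (on a given instance) are subsets of a finite ground set $U$, let $\operatorname{succ}$ be a successor function for $\Pi$ such that for every solution $S$ and every $x\in U\setminus S$, every set in $\operatorname{succ}(S,x)$ is a solution containing $x$, and let $M$ be the solution map implied by $\operatorname{succ}$. Suppose that for every solution $S^*$ there is a victim function $D$ for $S^*$ such that from every solution $S\neq S^*$ there exists a retaliation-free path (with respect to $S^*$ and $D$). Then $M$ is strongly connected.
   Context: A successor function is a map $\operatorname{succ}$ assigning to each solution $S$ and element $u\in U$ a set $\operatorname{succ}(S,u)$ of solutions. The solution map $M$ is the multiple digraph whose nodes are all solutions, with an arc from $S$ to $S'$ labeled $u$ for each $u$ with $S'\in\operatorname{succ}(S,u)$. For $X\subseteq U$, $\Sigma(X)$ denotes the set of sequences of distinct elements of $X$; for $\sigma\in\Sigma(X)$ and $x\in X$ not in $\sigma$, $\sigma+x$ is the sequence obtained by appending $x$. For a fixed solution $S^*$, a victim function is a map $D:\Sigma(S^* )\to\Sigma(S^* )$ such that (1) the elements of $D(\langle\rangle)$ are exactly the elements of $S^*$, and (2) for every $\sigma$ and every element $x$ of $D(\sigma)$, every element of $D(\sigma+x)$ appears before $x$ in $D(\sigma)$. A retaliation-free path from a solution $S$ is a sequence of solutions $S_0,S_1,S_2,\ldots$ in $M$ together with sequences $\sigma_0,\sigma_1,\ldots\in\Sigma(S^* )$, with $S_0=S$ and $\sigma_0=\langle\rangle$, which ends exactly when it reaches $S^*$, such that for every $i$ with $S_i\neq S^*$: (i) $S_{i+1}\in\operatorname{succ}(S_i,x_i)$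 where $x_i$ is the first element of $D(\sigma_i)$ not in $S_i$; (ii) every element of $(S_i\setminus S_{i+1})\cap S^*$ appears in $D(\sigma_i)$; (iii) $\sigma_{i+1}$ is the longest prefix $\sigma'$ of $\sigma_i+x_i$ such that at least one element of $D(\sigma')$ is not in $S_{i+1}$.
   Formalization: A retaliation-free path that never reaches S* must also satisfy: every element of (S_i \ S_{i+1}) ∩ S* appears in D(σ_i + x_i), not only in D(σ_i); if never-ending paths are allowed, the claim is false without this. At least one solution is assumed to exist. *)

theory Defs
  imports "Graph_Theory.Digraph_Component" "HOL-Library.Sublist"
begin

definition successor_function ::
  "'a set \<Rightarrow> 'a set set \<Rightarrow> ('a set \<Rightarrow> 'a \<Rightarrow> 'a set set) \<Rightarrow> bool" where
  "successor_function U Sols succ \<longleftrightarrow> (\<forall>S\<in>Sols. \<forall>u\<in>U. succ S u \<subseteq> Sols)"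

text \<open>An arc is a triple (source, label, target), so that parallel arcs with different labels
  are kept apart.\<close>

definition solution_map ::
  "'a set \<Rightarrow> 'a set set \<Rightarrow> ('a set \<Rightarrow> 'a \<Rightarrow> 'a set set) \<Rightarrow>
     ('a set, 'a set \<times> 'a \<times> 'a set) pre_digraph" where
  "solution_map U Sols succ =
     \<lparr> verts = Sols,
       arcs = {(S, u, S'). S \<in> Sols \<and> u \<in> U \<and> S' \<in> succ S u},
       tail = (\<lambda>(S, u, S'). S),
       head = (\<lambda>(S, u, S'). S') \<rparr>"

definition distinct_seqs :: "'a set \<Rightarrow> 'a list set" where
  "distinct_seqs X = {\<sigma>. distinct \<sigma> \<and> set \<sigma> \<subseteq> X}"

text \<open>The elements that appear before \<open>x\<close> in \<open>D \<sigma>\<close> are those of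
  \<open>takeWhile ((\<noteq>) x) (D \<sigma>)\<close>. The sequence \<open>\<sigma> + x\<close> only makes sense for \<open>x\<close> not in \<open>\<sigma>\<close>, hence
  the set difference.\<close>

definition victim_function :: "'a set \<Rightarrow> ('a list \<Rightarrow> 'a list) \<Rightarrow> bool" where
  "victim_function Sstar D \<longleftrightarrow>
     (\<forall>\<sigma>\<in>distinct_seqs Sstar. D \<sigma> \<in> distinct_seqs Sstar) \<and>
     set (D []) = Sstar \<and>
     (\<forall>\<sigma>\<in>distinct_seqs Sstar. \<forall>x\<in>set (D \<sigma>) - set \<sigma>.
        set (D (\<sigma> @ [x])) \<subseteq> set (takeWhile ((\<noteq>) x) (D \<sigma>)))"

definition first_missing :: "'a list \<Rightarrow> 'a set \<Rightarrow> 'a \<Rightarrow> bool" where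
  "first_missing xs S x \<longleftrightarrow> List.find (\<lambda>y. y \<notin> S) xs = Some x"

text \<open>The sequences are functions on \<open>nat\<close> of which only the part up to the first occurrence of
  \<open>Sstar\<close> counts (index \<open>i\<close> is running if \<open>Sstar\<close> has not been reached at \<open>i\<close> or earlier); values
  beyond it are junk. A sequence that never meets \<open>Sstar\<close> never ends. Once \<open>Sstar\<close> has been
  reached there is no prefix with a missing victim, so \<open>\<sigma>s\<close> is not constrained at the last
  index.\<close>

definition running :: "'a set \<Rightarrow> (nat \<Rightarrow> 'a set) \<Rightarrow> nat \<Rightarrow> bool" where
  "running Sstar Ss i \<longleftrightarrow> (\<forall>j\<le>i. Ss j \<noteq> Sstar)"

definition retaliation_free_path ::
  "'a set set \<Rightarrow> ('a set \<Rightarrow> 'a \<Rightarrow> 'a set set) \<Rightarrow> 'a set \<Rightarrow> ('a list \<Rightarrow> 'a list) \<Rightarrow> 'a set \<Rightarrow>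
     (nat \<Rightarrow> 'a set) \<Rightarrow> (nat \<Rightarrow> 'a list) \<Rightarrow> bool" where
  "retaliation_free_path Sols succ Sstar D S Ss \<sigma>s \<longleftrightarrow>
     Ss 0 = S \<and> \<sigma>s 0 = [] \<and> S \<in> Sols \<and>
     (\<forall>i. running Sstar Ss i \<longrightarrow>
        \<sigma>s i \<in> distinct_seqs Sstar \<and> Ss (Suc i) \<in> Sols \<and>
        (\<exists>x. first_missing (D (\<sigma>s i)) (Ss i) x \<and>
             Ss (Suc i) \<in> succ (Ss i) x \<and>
             (Ss i - Ss (Suc i)) \<inter> Sstar \<subseteq> set (D (\<sigma>s i)) \<and>
             (Ss (Suc i) \<noteq> Sstar \<longrightarrow>
                is_arg_max length
                  (\<lambda>\<sigma>'. prefix \<sigma>' (\<sigma>s i @ [x]) \<and> (\<exists>y\<in>set (D \<sigma>'). y \<notin> Ss (Suc i)))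
                  (\<sigma>s (Suc i)))))"

text \<open>Whether a retaliation-free path has to end is the delicate point. If never-ending sequences
  are admitted as they stand, their existence does not yield reachability. For instance, take
  \<open>U = {a, y, p}\<close>, the solutions \<open>{a, p}\<close>, \<open>{y, p}\<close>, \<open>{a, y}\<close>, and
  \<open>succ {a, p} y = {{y, p}}\<close>, \<open>succ {y, p} a = {{a, p}}\<close>,
  \<open>succ {a, y} p = {{a, p}, {y, p}}\<close>, all other values being empty. With
  \<open>D [] = [a, y]\<close> and \<open>D \<sigma> = []\<close> for every other \<open>\<sigma>\<close>, the sequence alternating between
  \<open>{a, p}\<close> and \<open>{y, p}\<close>, with all \<open>\<sigma>s i = []\<close>, is retaliation-free with respect to
  \<open>{a, y}\<close>, a solution that no arc enters. What excludes this is that the elements lost when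
  \<open>x\<close> is added are victims of \<open>x\<close>, that is, appear in \<open>D (\<sigma>s i @ [x])\<close> and not merely in
  \<open>D (\<sigma>s i)\<close>. The following condition says so; the theorem asks for it only of sequences that are
  not already known to end.\<close>

definition losses_are_victims ::
  "'a set \<Rightarrow> ('a list \<Rightarrow> 'a list) \<Rightarrow> (nat \<Rightarrow> 'a set) \<Rightarrow> (nat \<Rightarrow> 'a list) \<Rightarrow> bool" where
  "losses_are_victims Sstar D Ss \<sigma>s \<longleftrightarrow>
     (\<forall>i x. first_missing (D (\<sigma>s i)) (Ss i) x \<longrightarrow>
        (Ss i - Ss (Suc i)) \<inter> Sstar \<subseteq> set (D (\<sigma>s i @ [x])))"

end

theory Submission
  imports Defs
begin

text \<open>If a retaliation-free path to \<open>Sstar\<close> ends, it is a walk in the solution map. Suppose it never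
  ends, and let \<open>k\<close> be the limit inferior of the lengths of the \<open>\<sigma>s i\<close>, which are bounded by the
  size of \<open>Sstar\<close>. Between two late consecutive indices \<open>t < s\<close> at which the length is \<open>k\<close>, every
  \<open>\<sigma>s i\<close> extends \<open>\<rho> = \<sigma>s t @ [x]\<close>, with \<open>x\<close> the element added at \<open>t\<close>. As the sets of
  victims shrink along extensions, only victims of \<open>\<rho>\<close> are lost in between, and at \<open>s\<close> all
  victims of \<open>\<rho>\<close> are present because \<open>\<sigma>s s\<close> is shorter than \<open>\<rho>\<close>. So the intersection with the
  finite set \<open>Sstar\<close> has gained \<open>x\<close> and lost nothing, which cannot happen infinitely often.\<close>

text \<open>Each entry is a victim of the entries before it. Every \<open>\<sigma>s i\<close> has
  this property: appending a missing victim preserves it, and so does cutting back to a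
  prefix.\<close>

definition victim_chain :: "('a list \<Rightarrow> 'a list) \<Rightarrow> 'a list \<Rightarrow> bool" where
  "victim_chain D \<sigma> \<longleftrightarrow> (\<forall>\<rho> x. prefix (\<rho> @ [x]) \<sigma> \<longrightarrow> x \<in> set (D \<rho>))"

lemma victim_chain_Nil [simp]: "victim_chain D []"
  by (simp add: victim_chain_def)

lemma victim_chain_snoc [simp]:
  "victim_chain D (\<sigma> @ [x]) \<longleftrightarrow> victim_chain D \<sigma> \<and> x \<in> set (D \<sigma>)"
  by (auto simp: victim_chain_def)

lemma victim_chain_prefix: "victim_chain D \<sigma> \<Longrightarrow> prefix \<rho> \<sigma> \<Longrightarrow> victim_chain D \<rho>"
  unfolding victim_chain_def by (meson prefix_order.trans)

lemma victim_functionD: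
  assumes "victim_function X D" "\<sigma> \<in> distinct_seqs X"
  shows "set (D \<sigma>) \<subseteq> X"
    and "x \<in> set (D \<sigma>) - set \<sigma> \<Longrightarrow> set (D (\<sigma> @ [x])) \<subseteq> set (takeWhile ((\<noteq>) x) (D \<sigma>))"
  using assms by (auto simp: victim_function_def distinct_seqs_def)

lemma victims_snoc:
  assumes "victim_function X D" "\<sigma> \<in> distinct_seqs X" "x \<in> set (D \<sigma>) - set \<sigma>"
  shows "set (D (\<sigma> @ [x])) \<subseteq> set (D \<sigma>) - {x}"
proof -
  have "set (takeWhile ((\<noteq>) x) (D \<sigma>)) \<subseteq> set (D \<sigma>) - {x}"
    by (auto dest: set_takeWhileD)
  with victim_functionD(2)[OF assms] show ?thesis by blast
qed

text \<open>The two claims need a joint induction: disjointness makes the next entry new, so that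
  the condition on victim functions applies to it, and that condition then removes this entry from
  the victims.\<close>

lemma victim_chain_distinct:
  assumes "victim_function X D" "victim_chain D \<sigma>"
  shows "\<sigma> \<in> distinct_seqs X \<and> set (D \<sigma>) \<inter> set \<sigma> = {}"
  using assms(2)
proof (induction \<sigma> rule: rev_induct)
  case Nil
  then show ?case by (simp add: distinct_seqs_def)
next
  case (snoc x \<sigma>)
  then have IH: "\<sigma> \<in> distinct_seqs X" "set (D \<sigma>) \<inter> set \<sigma> = {}" "x \<in> set (D \<sigma>)"
    by auto
  have "x \<in> X" using victim_functionD(1)[OF assms(1) IH(1)] IH(3) by blast
  moreover have "set (D (\<sigma> @ [x])) \<subseteq> set (D \<sigma>) - {x}"
    using victims_snoc[OF assms(1) IH(1)] IH by blast
  ultimately show ?case using IH by (auto simp: distinct_seqs_def)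
qed

text \<open>Along a chain each appended entry is a new victim, so \<open>victims_snoc\<close>
  applies one entry at a time.\<close>

lemma victims_antimono:
  assumes "victim_function X D" "victim_chain D \<sigma>" "prefix \<rho> \<sigma>"
  shows "set (D \<sigma>) \<subseteq> set (D \<rho>)"
  using assms(2,3)
proof (induction \<sigma> rule: rev_induct)
  case Nil
  then show ?case by simp
next
  case (snoc x \<sigma>)
  show ?case
  proof (cases "\<rho> = \<sigma> @ [x]")
    case False
    with snoc have "set (D \<sigma>) \<subseteq> set (D \<rho>)" by auto
    moreover have "set (D (\<sigma> @ [x])) \<subseteq> set (D \<sigma>) - {x}"
      using victims_snoc[OF assms(1)] victim_chain_distinct[OF assms(1), of \<sigma>] snoc.prems by auto
    ultimately show ?thesis by blast
  qed simp
qed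

lemma first_missingD:
  assumes "first_missing xs S x"
  shows "x \<in> set xs" "x \<notin> S"
  using assms by (auto simp: first_missing_def find_Some_iff)

text \<open>\<open>k\<close> is the least bound that \<open>f\<close> satisfies infinitely often. By
  minimality smaller values eventually stop, so from then on the bound is met with equality.\<close>

lemma nat_liminf:
  fixes f :: "nat \<Rightarrow> nat"
  assumes "\<And>i. f i \<le> N"
  obtains k m where "\<And>i. i \<ge> m \<Longrightarrow> f i \<ge> k" "\<And>n. \<exists>i\<ge>n. f i = k"
proof -
  define P where "P = (\<lambda>k. \<forall>n. \<exists>i\<ge>n. f i \<le> k)"
  have "P N" using assms by (auto simp: P_def)
  define k where "k = (LEAST k. P k)"
  have k: "P k" unfolding k_def using \<open>P N\<close> by (rule LeastI)
  have "\<exists>m. \<forall>i\<ge>m. f i \<ge> k"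
  proof (cases k)
    case (Suc j)
    then have "\<not> P j" using not_less_Least[of j P] by (simp add: k_def)
    then obtain n where "\<forall>i\<ge>n. \<not> f i \<le> j" by (auto simp: P_def)
    then show ?thesis using Suc by (auto simp: not_le Suc_le_eq)
  qed simp
  then obtain m where m: "\<And>i. i \<ge> m \<Longrightarrow> f i \<ge> k" by blast
  have "\<exists>i\<ge>n. f i = k" for n
  proof -
    obtain i where "i \<ge> max m n" "f i \<le> k" using k unfolding P_def by blast
    with m[of i] show ?thesis by (auto intro!: exI[of _ i])
  qed
  with m show thesis by (rule that)
qed

lemma retaliation_free_path_step:
  assumes "retaliation_free_path Sols succ X D S Ss \<sigma>s" "running X Ss i"
  shows "\<sigma>s i \<in> distinct_seqs X"
    and "Ss (Suc i) \<in> Sols"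
    and "\<exists>x. first_missing (D (\<sigma>s i)) (Ss i) x \<and> Ss (Suc i) \<in> succ (Ss i) x \<and>
      (Ss (Suc i) \<noteq> X \<longrightarrow> is_arg_max length
        (\<lambda>\<sigma>'. prefix \<sigma>' (\<sigma>s i @ [x]) \<and> (\<exists>y\<in>set (D \<sigma>'). y \<notin> Ss (Suc i))) (\<sigma>s (Suc i)))"
proof -
  note step = assms(1)[unfolded retaliation_free_path_def, THEN conjunct2, THEN conjunct2,
      THEN conjunct2, rule_format, OF assms(2)]
  show "\<sigma>s i \<in> distinct_seqs X" "Ss (Suc i) \<in> Sols"
    using step by auto
  from step obtain x where "first_missing (D (\<sigma>s i)) (Ss i) x" "Ss (Suc i) \<in> succ (Ss i) x"
    "Ss (Suc i) \<noteq> X \<longrightarrow> is_arg_max length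
      (\<lambda>\<sigma>'. prefix \<sigma>' (\<sigma>s i @ [x]) \<and> (\<exists>y\<in>set (D \<sigma>'). y \<notin> Ss (Suc i))) (\<sigma>s (Suc i))"
    by (elim conjE exE) (rule that)
  then show "\<exists>x. first_missing (D (\<sigma>s i)) (Ss i) x \<and> Ss (Suc i) \<in> succ (Ss i) x \<and>
      (Ss (Suc i) \<noteq> X \<longrightarrow> is_arg_max length
        (\<lambda>\<sigma>'. prefix \<sigma>' (\<sigma>s i @ [x]) \<and> (\<exists>y\<in>set (D \<sigma>'). y \<notin> Ss (Suc i))) (\<sigma>s (Suc i)))"
    by (intro exI conjI)
qed

lemma retaliation_free_path_ends:
  assumes fin: "finite X" and D: "victim_function X D"
    and grow: "\<And>S x S'. S \<in> Sols \<Longrightarrow> x \<in> X - S \<Longrightarrow> S' \<in> succ S x \<Longrightarrow> x \<in> S'"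
    and path: "retaliation_free_path Sols succ X D S Ss \<sigma>s"
    and losses: "(\<forall>n. Ss n \<noteq> X) \<longrightarrow> losses_are_victims X D Ss \<sigma>s"
  shows "\<exists>n. Ss n = X"
proof (rule ccontr)
  assume "\<nexists>n. Ss n = X"
  then have never: "Ss n \<noteq> X" for n by blast
  then have run: "running X Ss i" for i by (simp add: running_def)
  have Sols: "Ss i \<in> Sols" for i
    using path retaliation_free_path_step(2)[OF path run]
    by (cases i) (auto simp: retaliation_free_path_def)
  have "\<exists>x. first_missing (D (\<sigma>s i)) (Ss i) x \<and> Ss (Suc i) \<in> succ (Ss i) x \<and>
      is_arg_max length (\<lambda>\<sigma>'. prefix \<sigma>' (\<sigma>s i @ [x]) \<and> (\<exists>y\<in>set (D \<sigma>'). y \<notin> Ss (Suc i)))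
        (\<sigma>s (Suc i))" (is "\<exists>x. ?P i x") for i
    using retaliation_free_path_step(3)[OF path run[of i]] never[of "Suc i"] by simp
  then have "\<exists>x. \<forall>i. ?P i (x i)"
    by (intro choice allI)
  then obtain x where "\<forall>i. ?P i (x i)" ..
  then have miss: "\<And>i. first_missing (D (\<sigma>s i)) (Ss i) (x i)"
    and succ: "\<And>i. Ss (Suc i) \<in> succ (Ss i) (x i)"
    and longest: "\<And>i. is_arg_max length (\<lambda>\<sigma>'. prefix \<sigma>' (\<sigma>s i @ [x i]) \<and>
      (\<exists>y\<in>set (D \<sigma>'). y \<notin> Ss (Suc i))) (\<sigma>s (Suc i))"
    by (blast dest: spec)+
  note x = first_missingD[OF miss]
  have pre: "prefix (\<sigma>s (Suc i)) (\<sigma>s i @ [x i])" for i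
    using longest[of i] by (simp add: is_arg_max_def)
  \<comment> \<open>A prefix longer than the longest one with a missing victim has none
    missing.\<close>
  have full: "set (D \<rho>) \<subseteq> Ss (Suc i)"
    if "prefix \<rho> (\<sigma>s i @ [x i])" "length (\<sigma>s (Suc i)) < length \<rho>" for \<rho> i
    using longest[of i] that by (auto simp: is_arg_max_def)
  have chain: "victim_chain D (\<sigma>s i)" for i
  proof (induction i)
    case 0
    then show ?case using path by (simp add: retaliation_free_path_def)
  next
    case (Suc i)
    then have "victim_chain D (\<sigma>s i @ [x i])" using x by simp
    then show ?case using pre by (rule victim_chain_prefix)
  qed
  have chain': "victim_chain D (\<sigma>s i @ [x i])" for i using chain x by simp
  have xX: "x i \<in> X" for i
    using victim_functionD(1)[OF D] victim_chain_distinct[OF D chain] x(1) by blast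
  have x_Suc: "x i \<in> Ss (Suc i)" for i
    using grow[OF Sols _ succ] xX x(2) by blast
  \<comment> \<open>The assumption that the path never ends supplies the premise of
    \<open>losses\<close>.\<close>
  have lost: "(Ss i - Ss (Suc i)) \<inter> X \<subseteq> set (D (\<sigma>s i @ [x i]))" for i
    using losses never miss unfolding losses_are_victims_def by blast
  have "length (\<sigma>s i) \<le> card X" for i
    using victim_chain_distinct[OF D chain, of i] fin
    by (metis (no_types, lifting) card_mono distinct_card distinct_seqs_def mem_Collect_eq)
  then obtain k m where ge: "\<And>i. i \<ge> m \<Longrightarrow> length (\<sigma>s i) \<ge> k"
    and inf: "\<And>n. \<exists>i\<ge>n. length (\<sigma>s i) = k"
    by (rule nat_liminf[of "\<lambda>i. length (\<sigma>s i)"]) (rule that)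
  have "\<exists>t. t \<ge> m \<and> length (\<sigma>s t) = k"
    using inf[of m] by blast
  \<comment> \<open>An extremal choice of \<open>t\<close>: as few elements of \<open>X\<close> as
    possible are missing. The next return to length \<open>k\<close> will have strictly fewer
    missing.\<close>
  then obtain t where t: "t \<ge> m" "length (\<sigma>s t) = k"
    and min: "\<And>s. s \<ge> m \<Longrightarrow> length (\<sigma>s s) = k \<Longrightarrow> card (X - Ss t) \<le> card (X - Ss s)"
    using ex_has_least_nat[of "\<lambda>i. i \<ge> m \<and> length (\<sigma>s i) = k" _ "\<lambda>i. card (X - Ss i)"] by blast
  \<comment> \<open>Offsets count from \<open>Suc t\<close>, so the least \<open>d\<close> gives the
    next return to length \<open>k\<close>, possibly immediately with \<open>d = 0\<close>.\<close>
  define Q where "Q = (\<lambda>d. length (\<sigma>s (Suc t + d)) = k)"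
  have "\<exists>d. Q d" using inf[of "Suc t"] by (metis Q_def le_Suc_ex)
  then obtain d where d: "Q d" and before: "\<And>e. e < d \<Longrightarrow> \<not> Q e"
    using exists_least_iff[of Q] by blast
  define \<rho> where "\<rho> = \<sigma>s t @ [x t]"
  \<comment> \<open>Strictly between the two returns the length is at least \<open>k\<close> but not
    \<open>k\<close>, hence at least \<open>k + 1\<close>.\<close>
  have len: "length \<rho> \<le> length (\<sigma>s (Suc t + e))" if "e < d" for e
    using before[OF that] ge[of "Suc t + e"] t by (simp add: Q_def \<rho>_def)
  \<comment> \<open>Stated for the sequence before it is cut back, so that \<open>e = d\<close> is
    included, where the cut goes below \<open>\<rho>\<close>.\<close>
  have step: "prefix \<rho> (\<sigma>s (t + e) @ [x (t + e)])" if "e \<le> d" for e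
    using that
  proof (induction e)
    case 0
    then show ?case by (simp add: \<rho>_def)
  next
    case (Suc e)
    then have "prefix \<rho> (\<sigma>s (Suc t + e))"
      using prefix_length_prefix[of \<rho> "\<sigma>s (t + e) @ [x (t + e)]"] pre[of "t + e"] len[of e]
      by simp
    then show ?case by simp
  qed
  have D\<rho>: "set (D (\<sigma>s (t + e) @ [x (t + e)])) \<subseteq> set (D \<rho>)" if "e \<le> d" for e
    using victims_antimono[OF D chain' step[OF that]] .
  have D\<rho>_full: "set (D \<rho>) \<subseteq> Ss (Suc t + d)"
    using full[OF step[of d]] d t by (simp add: Q_def \<rho>_def)
  \<comment> \<open>The steps from \<open>t\<close> to \<open>t + d\<close> lose only victims of
    \<open>\<rho>\<close> among the elements of \<open>X\<close>, so any other element of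
    \<open>X\<close> stays once present.\<close>
  have keep: "y \<in> Ss (Suc t + e)"
    if "e \<le> d" "y \<in> X" "y \<in> Ss t \<or> y = x t" "y \<notin> set (D \<rho>)" for y e
    using that(1)
  proof (induction e)
    case 0
    then show ?case using that x_Suc[of t] lost[of t] by (auto simp: \<rho>_def)
  next
    case (Suc e)
    then show ?case using that lost[of "t + Suc e"] D\<rho>[of "Suc e"] by auto
  qed
  \<comment> \<open>Victims of \<open>\<rho>\<close> may be lost on the way, but all are back at the
    end by \<open>D\<rho>_full\<close>; the others are covered by \<open>keep\<close>.\<close>
  have "X - Ss (Suc t + d) \<subseteq> X - Ss t - {x t}"
    using keep[OF order_refl] D\<rho>_full by blast
  then have "X - Ss (Suc t + d) \<subset> X - Ss t" using xX[of t] x(2)[of t] by blast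
  then have "card (X - Ss (Suc t + d)) < card (X - Ss t)"
    using fin by (intro psubset_card_mono) auto
  with min[of "Suc t + d"] d t show False by (simp add: Q_def)
qed

lemma solution_map_arc:
  assumes "S \<in> Sols" "u \<in> U" "S' \<in> succ S u" "S' \<in> Sols"
  shows "S \<rightarrow>\<^bsub>solution_map U Sols succ\<^esub> S'"
proof -
  have "(S, u, S') \<in> arcs (solution_map U Sols succ)"
    using assms by (simp add: solution_map_def)
  then have "arc_to_ends (solution_map U Sols succ) (S, u, S') \<in> arcs_ends (solution_map U Sols succ)"
    unfolding arcs_ends_def by (rule imageI)
  then show ?thesis by (simp add: arc_to_ends_def solution_map_def)
qed

lemma retaliation_free_path_reachable:
  assumes D: "victim_function X D" and "X \<subseteq> U"
    and path: "retaliation_free_path Sols succ X D S Ss \<sigma>s"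
    and "Ss n = X"
  shows "S \<rightarrow>\<^sup>*\<^bsub>solution_map U Sols succ\<^esub> X"
proof -
  let ?M = "solution_map U Sols succ"
  \<comment> \<open>The first visit to \<open>X\<close> is needed, because the path conditions hold
    only at running indices.\<close>
  define l where "l = (LEAST n. Ss n = X)"
  have l: "Ss l = X" unfolding l_def using assms(4) by (rule LeastI)
  have "i \<le> l \<Longrightarrow> Ss i \<in> Sols \<and> S \<rightarrow>\<^sup>*\<^bsub>?M\<^esub> Ss i" for i
  proof (induction i)
    case 0
    have "Ss 0 = S" "S \<in> Sols"
      using path unfolding retaliation_free_path_def by simp_all
    then show ?case by (simp add: reachable_def solution_map_def)
  next
    case (Suc i)
    then have IH: "Ss i \<in> Sols" "S \<rightarrow>\<^sup>*\<^bsub>?M\<^esub> Ss i" by simp_all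
    have "running X Ss i"
      using Suc.prems not_less_Least[of _ "\<lambda>n. Ss n = X", folded l_def]
      by (simp add: running_def)
    note step = retaliation_free_path_step[OF path this]
    from step(3) obtain x where x: "first_missing (D (\<sigma>s i)) (Ss i) x" "Ss (Suc i) \<in> succ (Ss i) x"
      by (elim exE conjE) (rule that)
    have "x \<in> U"
      using first_missingD(1)[OF x(1)] victim_functionD(1)[OF D step(1)] \<open>X \<subseteq> U\<close> by blast
    then have arc: "Ss i \<rightarrow>\<^bsub>?M\<^esub> Ss (Suc i)"
      using IH(1) x(2) step(2) by (intro solution_map_arc)
    have "Ss (Suc i) \<in> verts ?M" using step(2) by (simp add: solution_map_def)
    with IH(2) arc have "S \<rightarrow>\<^sup>*\<^bsub>?M\<^esub> Ss (Suc i)"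
      unfolding reachable_def by (rule rtrancl_on_into_rtrancl_on)
    with step(2) show ?case by simp
  qed
  from this[of l] show ?thesis using l by simp
qed

theorem theorem3p1:
  fixes U :: "'a set"
    and Sols :: "'a set set"
    and succ :: "'a set \<Rightarrow> 'a \<Rightarrow> 'a set set"
  assumes "finite U"
    and "Sols \<subseteq> Pow U"
    and "Sols \<noteq> {}"
    and "successor_function U Sols succ"
    and "\<And>S x S'. S \<in> Sols \<Longrightarrow> x \<in> U - S \<Longrightarrow> S' \<in> succ S x \<Longrightarrow> S' \<in> Sols \<and> x \<in> S'"
    and "\<And>Sstar. Sstar \<in> Sols \<Longrightarrow>
           \<exists>D. victim_function Sstar D \<and>
             (\<forall>S\<in>Sols. S \<noteq> Sstar \<longrightarrow>
               (\<exists>Ss \<sigma>s. retaliation_free_path Sols succ Sstar D S Ss \<sigma>s \<and>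
                  ((\<forall>n. Ss n \<noteq> Sstar) \<longrightarrow> losses_are_victims Sstar D Ss \<sigma>s)))"
  shows "strongly_connected (solution_map U Sols succ)"
proof -
  have "S \<rightarrow>\<^sup>*\<^bsub>solution_map U Sols succ\<^esub> X" if S: "S \<in> Sols" and X: "X \<in> Sols" for S X
  proof (cases "S = X")
    case True
    then show ?thesis using S by (auto simp: reachable_def solution_map_def)
  next
    case False
    have "X \<subseteq> U" using assms(2) X by blast
    obtain D Ss \<sigma>s where D: "victim_function X D"
      and path: "retaliation_free_path Sols succ X D S Ss \<sigma>s"
      and losses: "(\<forall>n. Ss n \<noteq> X) \<longrightarrow> losses_are_victims X D Ss \<sigma>s"
      using assms(6)[OF X] S False by metis
    have "\<exists>n. Ss n = X"
    proof (rule retaliation_free_path_ends[OF _ D _ path losses])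
      show "finite X" using \<open>X \<subseteq> U\<close> assms(1) by (rule finite_subset)
      \<comment> \<open>Elements added on the way to \<open>X\<close> lie in \<open>U\<close>, so
        the growth property of \<open>succ\<close> restricts to them.\<close>
      show "x \<in> S'" if "S \<in> Sols" "x \<in> X - S" "S' \<in> succ S x" for S x S'
        using assms(5)[OF that(1) _ that(3)] that(2) \<open>X \<subseteq> U\<close> by blast
    qed
    then obtain n where "Ss n = X" ..
    with D \<open>X \<subseteq> U\<close> path show ?thesis by (rule retaliation_free_path_reachable)
  qed
  then show ?thesis using assms(3) by (simp add: strongly_connected_def solution_map_def)
qed

end
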